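(* Let $(B,\Lambda,\underline v)$ be a bow diagram of affine type A with $\underline v\in\mathbb N^{\mathcal I^s}$ such that $\mu_{(B,\Lambda,\underline v)}^{-1}(\lambda)\ne\varnothing$ for some $\lambda\in\mathbb C^{\mathcal I}$. (i) Suppose $\lambda=0$. If $(B,\Lambda,\underline v^{new})$ is obtained from $(B,\Lambda,\underline v)$ via supersymmetric increments between arrows, then $\mu^{-1}_{(B,\Lambda,\underline v^{new})}(0)\ne\varnothing$. (ii) Suppose $x_1,x_2\in\Lambda$ are two consecutive x-points on the same wavy line, ordered according to the orientation of the wavy line, and let $\zeta=\zeta_{x_1}^+=\zeta_{x_2}^-$. If $\underline v^{new}\in\mathbb N^{\mathcal I^s}$ satisfies $v^{new}_\zeta-v_\zeta\in\mathbb N$ and $v^{new}_{\zeta'}=v_{\zeta'}$ for all $\zeta'\ne\zeta$, then $\mu^{-1}_{(B,\Lambda,\underline v^{new})}(\lambda)\neq\varnothing$.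
   Context: $\mathbb N=\{0,1,2,\dots\}$. **Bow diagrams.** Fix $n,w\ge 0$ with $n+w\ge1$. An affine type A bow diagram $(B,\Lambda,\underline v)$ consists of an anticlockwise oriented circle carrying $n$ arrows (set $\mathcal E$) and a set $\Lambda$ of $w$ x-points. Between the head of an arrow and the tail of the next arrow (anticlockwise) there is a wavy line; $\mathcal I$ is the set of wavy lines (if $n=1$ there is one wavy line, from the head to the tail of the unique arrow; if $n=0$ there is one closed wavy line). The x-points lie on the wavy lines and divide them into segments; $\mathcal I^s$ is the set of segments, i.e. of the $n+w$ arcs between consecutive elements of $\mathcal E\sqcup\Lambda$. The dimension vector is $\underline v=(v_\zeta)\in\mathbb Z^{\mathcal I^s}$. For an arrow $e$, $v_{t(e)},v_{h(e)}$ are the dimensions of the segments at its tail and head. For an x-point $x$, $\zeta_x^-,\zeta_x^+$ are the segments just before and just after $x$ anticlockwise, with dimensions $v_x^\pm$. **Supersymmetric increments between arrows.** $(B,\Lambda,\underline v')$ is obtained from $(B,\Lambda,\underline v)$ via a supersymmetric increment between two arrows $e,e'$ (possibly equal) if $v'_\zeta-v_\zeta\ge0$ for all $\zeta$ and $v'_\zeta-v_\zeta$ depends only on which of the arcs into which the circle is cut by $e,e'$ contains $\zeta$. The term also refers to successive applications of these operations. **Moment map.** Let $\underline v\in\mathbb N^{\mathcal I^s}$. For $e\in\mathcal E$ let $\mathcal M^e$ be the space of pairs $(C_e,D_e)$, $C_e:\mathbb C^{v_{t(e)}}\to\mathbb C^{v_{h(e)}}$, $D_e:\mathbb C^{v_{h(e)}}\to\mathbb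 C^{v_{t(e)}}$ linear. For $x\in\Lambda$ let $\mathcal M^x$ be the space of tuples $(A_x,B_x^-,B_x^+,a_x,b_x)$ of linear maps $A_x:\mathbb C^{v_x^-}\to\mathbb C^{v_x^+}$, $B_x^\pm\in\mathrm{End}(\mathbb C^{v_x^\pm})$, $a_x:\mathbb C\to\mathbb C^{v_x^+}$, $b_x:\mathbb C^{v_x^-}\to\mathbb C$ with (1) $B_x^+A_x-A_xB_x^-+a_xb_x=0$; (2) no nonzero $B_x^-$-invariant subspace is contained in $\ker A_x\cap\ker b_x$; (3) no proper $B_x^+$-invariant subspace of $\mathbb C^{v_x^+}$ contains $\mathrm{Im}A_x+\mathrm{Im}\,a_x$. Put $\widetilde{\mathcal M}=\prod_x\mathcal M^x\times\bigoplus_e\mathcal M^e$. The map $\mu=\mu_{(B,\Lambda,\underline v)}:\widetilde{\mathcal M}\to\bigoplus_\zeta\mathfrak{gl}(v_\zeta)$ has $\zeta$-component equal to the sum of the contributions of the two neighbours of $\zeta$: if the element just before $\zeta$ (anticlockwise) is an arrow $e$ it contributes $C_eD_e$, if it is an x-point $x$ it contributes $-B_x^+$; if the element just after $\zeta$ is an arrow $e$ it contributes $-D_eC_e$, if it is an x-point $x$ it contributes $B_x^-$. A parameter $\lambda\in\mathbb C^{\mathcal I}$ is viewed in $\bigoplus_\zeta\mathfrak{gl}(v_\zeta)$ as $\lambda_\sigma\mathrm{Id}$ on the first segment of each wavy line $\sigma$ and $0$ on the other segments (if $n=0$, a fixed segment is designated as first). *)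

theory Defs
  imports "Jordan_Normal_Form.VS_Connect" "Jordan_Normal_Form.Matrix_Kernel"
begin

section \<open>Bow diagrams of affine type A\<close>

text \<open>
  A bow diagram with \<open>n\<close> arrows and \<open>w\<close> x-points is the list of its \<open>n + w\<close> arrows and x-points
  in anticlockwise order, starting from an arbitrary one of them; it is required to be nonempty.
  Elements are referred to by their position \<open>i < length B\<close>. All arrows point anticlockwise.
  The segment \<open>i\<close> is the arc from element \<open>i\<close> to the next element (cyclically), so segments too are
  numbered by \<open>i < length B\<close>. If \<open>length B = 1\<close>, the unique segment lies both before and after the
  unique element.
\<close>

datatype bow_elt = Arrow | XPoint

type_synonym bow = "bow_elt list"

definition arrows :: "bow \<Rightarrow> nat set" where
  "arrows B = {i. i < length B \<and> B ! i = Arrow}"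

definition xpoints :: "bow \<Rightarrow> nat set" where
  "xpoints B = {i. i < length B \<and> B ! i = XPoint}"

definition next_elt :: "bow \<Rightarrow> nat \<Rightarrow> nat" where
  "next_elt B \<zeta> = Suc \<zeta> mod length B"

definition seg_after :: "bow \<Rightarrow> nat \<Rightarrow> nat" where
  "seg_after B i = i"

definition seg_before :: "bow \<Rightarrow> nat \<Rightarrow> nat" where
  "seg_before B i = (i + length B - 1) mod length B"

text \<open>
  A wavy line is represented by its first segment, which is the segment at the head of an arrow.
  If there are no arrows there is one closed wavy line, whose designated first segment is
  segment \<open>0\<close>; as the list may start anywhere on the circle, this is no restriction.
\<close>

definition wavy_lines :: "bow \<Rightarrow> nat set" where
  "wavy_lines B = (if arrows B = {} then {0} else seg_after B ` arrows B)"


section \<open>Supersymmetric increments between arrows\<close>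

text \<open>
  The segments met when moving anticlockwise from element \<open>e\<close> until \<open>e'\<close> is reached;
  for \<open>e = e'\<close> these are all the segments.
\<close>

definition circle_arc :: "bow \<Rightarrow> nat \<Rightarrow> nat \<Rightarrow> nat set" where
  "circle_arc B e e' = (if e < e' then {e..<e'} else {e..<length B} \<union> {..<e'})"

definition susy_increment_step :: "bow \<Rightarrow> int list \<Rightarrow> int list \<Rightarrow> bool" where
  "susy_increment_step B v v' \<longleftrightarrow>
     length v = length B \<and> length v' = length B \<and>
     (\<exists>e \<in> arrows B. \<exists>e' \<in> arrows B.
        (\<forall>\<zeta> < length B. v' ! \<zeta> - v ! \<zeta> \<ge> 0) \<and>
        (\<forall>S \<in> {circle_arc B e e', circle_arc B e' e}. \<forall>\<zeta> \<in> S. \<forall>\<zeta>' \<in> S.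
           v' ! \<zeta> - v ! \<zeta> = v' ! \<zeta>' - v ! \<zeta>'))"

definition susy_increment :: "bow \<Rightarrow> int list \<Rightarrow> int list \<Rightarrow> bool" where
  "susy_increment B = (susy_increment_step B)\<^sup>+\<^sup>+"


section \<open>The moment map\<close>

text \<open>
  Linear maps from \<open>\<complex>\<^sup>m\<close> to \<open>\<complex>\<^sup>n\<close> are \<open>n \<times> m\<close> matrices. The components of
  \<open>XPoint_data A Bm Bp a b\<close> are \<open>A\<^sub>x\<close>, \<open>B\<^sub>x\<^sup>-\<close>, \<open>B\<^sub>x\<^sup>+\<close>, \<open>a\<^sub>x\<close>, \<open>b\<^sub>x\<close>.
\<close>

datatype elt_data =
    Arrow_data "complex mat" "complex mat"
  | XPoint_data "complex mat" "complex mat" "complex mat" "complex mat" "complex mat"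

definition invariant_subspace :: "nat \<Rightarrow> complex mat \<Rightarrow> complex vec set \<Rightarrow> bool" where
  "invariant_subspace n M W \<longleftrightarrow>
     VectorSpace.subspace class_ring W (module_vec TYPE(complex) n) \<and>
     (\<forall>u \<in> W. M *\<^sub>v u \<in> W)"

text \<open>
  In the next two definitions \<open>vm\<close> and \<open>vp\<close> are the dimensions of the segments just before and just
  after the element.
\<close>

definition arrow_space :: "nat \<Rightarrow> nat \<Rightarrow> elt_data set" where
  "arrow_space vm vp =
     {Arrow_data C D | C D. C \<in> carrier_mat vp vm \<and> D \<in> carrier_mat vm vp}"

definition xpoint_space :: "nat \<Rightarrow> nat \<Rightarrow> elt_data set" where
  "xpoint_space vm vp =
     {XPoint_data A Bm Bp a b | A Bm Bp a b.
        A \<in> carrier_mat vp vm \<and> Bm \<in> carrier_mat vm vm \<and> Bp \<in> carrier_mat vp vp \<and>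
        a \<in> carrier_mat vp 1 \<and> b \<in> carrier_mat 1 vm \<and>
        Bp * A - A * Bm + a * b = 0\<^sub>m vp vm \<and>
        \<not> (\<exists>W. invariant_subspace vm Bm W \<and> W \<noteq> {0\<^sub>v vm} \<and>
               W \<subseteq> mat_kernel A \<inter> mat_kernel b) \<and>
        \<not> (\<exists>W. invariant_subspace vp Bp W \<and> W \<noteq> carrier_vec vp \<and>
               {A *\<^sub>v u + a *\<^sub>v c | u c. u \<in> carrier_vec vm \<and> c \<in> carrier_vec 1} \<subseteq> W)}"

definition elt_space :: "bow \<Rightarrow> nat list \<Rightarrow> nat \<Rightarrow> elt_data set" where
  "elt_space B v i =
     (case B ! i of
        Arrow \<Rightarrow> arrow_space (v ! seg_before B i) (v ! seg_after B i)
      | XPoint \<Rightarrow> xpoint_space (v ! seg_before B i) (v ! seg_after B i))"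

definition Mtilde :: "bow \<Rightarrow> nat list \<Rightarrow> (nat \<Rightarrow> elt_data) set" where
  "Mtilde B v = (\<Pi>\<^sub>E i\<in>{..<length B}. elt_space B v i)"

fun contrib_after :: "elt_data \<Rightarrow> complex mat" where
  "contrib_after (Arrow_data C D) = C * D"
| "contrib_after (XPoint_data A Bm Bp a b) = - Bp"

fun contrib_before :: "elt_data \<Rightarrow> complex mat" where
  "contrib_before (Arrow_data C D) = - (D * C)"
| "contrib_before (XPoint_data A Bm Bp a b) = Bm"

text \<open>
  The element just before segment \<open>\<zeta>\<close> is \<open>\<zeta>\<close>. The value of the moment map and the parameter are
  families of matrices indexed by the segments.
\<close>

definition moment_map :: "bow \<Rightarrow> (nat \<Rightarrow> elt_data) \<Rightarrow> nat \<Rightarrow> complex mat" where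
  "moment_map B m =
     (\<lambda>\<zeta>\<in>{..<length B}. contrib_after (m \<zeta>) + contrib_before (m (next_elt B \<zeta>)))"

definition param :: "bow \<Rightarrow> nat list \<Rightarrow> (nat \<Rightarrow> complex) \<Rightarrow> nat \<Rightarrow> complex mat" where
  "param B v lam =
     (\<lambda>\<zeta>\<in>{..<length B}. if \<zeta> \<in> wavy_lines B then lam \<zeta> \<cdot>\<^sub>m 1\<^sub>m (v ! \<zeta>)
                        else 0\<^sub>m (v ! \<zeta>) (v ! \<zeta>))"

definition moment_fiber :: "bow \<Rightarrow> nat list \<Rightarrow> (nat \<Rightarrow> complex) \<Rightarrow> (nat \<Rightarrow> elt_data) set" where
  "moment_fiber B v lam = {m \<in> Mtilde B v. moment_map B m = param B v lam}"

end

theory Submission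
  imports Defs "Jordan_Normal_Form.Spectral_Radius"
begin

text \<open>
  Both parts are proved by enlarging a given point of the fibre by direct sums, in such a way that the
  moment map stays under control on the new coordinates.

  For supersymmetric increments and parameter zero, the only property of the increment that matters
  is that it takes equal values on the two segments adjacent to an x-point. The new coordinates are
  carried through every x-point by the identity, and all other new components of the point are zero
  (\<open>moment_fiber_pad\<close>, using \<open>xpoint_pad\<close>).

  For a segment between two consecutive x-points \<open>x\<^sub>1\<close>, \<open>x\<^sub>2\<close> the dimension is raised one by one. The
  moment map on this segment only involves \<open>B\<^sup>+\<close> of \<open>x\<^sub>1\<close> and \<open>B\<^sup>-\<close> of \<open>x\<^sub>2\<close>; both are enlarged by
  a one-dimensional block, with eigenvalues \<open>r\<close> and \<open>r\<close> plus the parameter. If \<open>r\<close> is generic, these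
  eigenvalues are separate from all the old ones, so that the remaining entries of the x-point data
  are found by inverting \<open>B\<^sup>\<plusminus> - r\<close>, and the new eigenline is reached by \<open>a\<close> of \<open>x\<^sub>1\<close> and seen by
  \<open>b\<close> of \<open>x\<^sub>2\<close>, which gives the stability conditions (\<open>xpoint_extend_after\<close>,
  \<open>xpoint_extend_before\<close>). The matrices at the outer ends of \<open>x\<^sub>1\<close> and \<open>x\<^sub>2\<close> are left as they are, so
  the moment map does not change elsewhere.
\<close>

section \<open>Subspaces and x-point data in terms of vectors\<close>

lemma invariant_subspace_iff:
  "invariant_subspace n M W \<longleftrightarrow>
     W \<subseteq> carrier_vec n \<and> 0\<^sub>v n \<in> W \<and> (\<forall>u\<in>W. \<forall>v\<in>W. u + v \<in> W) \<and>
     (\<forall>c. \<forall>u\<in>W. c \<cdot>\<^sub>v u \<in> W) \<and> (\<forall>u\<in>W. M *\<^sub>v u \<in> W)"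
  unfolding invariant_subspace_def VectorSpace.subspace_def submodule_def
  using vec_vs[of n] vec_module[of n] by (auto simp: module_vec_simps class_ring_simps)

lemma mat_eq_if_mult_vec_eq:
  fixes M N :: "'a :: semiring_1 mat"
  assumes M: "M \<in> carrier_mat n m" and N: "N \<in> carrier_mat n m"
    and eq: "\<And>u. u \<in> carrier_vec m \<Longrightarrow> M *\<^sub>v u = N *\<^sub>v u"
  shows "M = N"
proof (rule eq_matI)
  fix i j assume "i < dim_row N" "j < dim_col N"
  then have ij: "i < n" "j < m" using N by auto
  have "(M *\<^sub>v unit_vec m j) $ i = (N *\<^sub>v unit_vec m j) $ i" using eq[of "unit_vec m j"] by simp
  then show "M $$ (i, j) = N $$ (i, j)" using M N ij by simp
qed (use M N in auto)

text \<open>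
  The defining conditions tested on vectors. In this form a block extension is checked by evaluating
  its matrices on concatenated vectors \<open>u @\<^sub>v t\<close>, without any block matrix algebra.
\<close>

lemma xpoint_space_iff:
  "XPoint_data A Bm Bp a b \<in> xpoint_space vm vp \<longleftrightarrow>
     A \<in> carrier_mat vp vm \<and> Bm \<in> carrier_mat vm vm \<and> Bp \<in> carrier_mat vp vp \<and>
     a \<in> carrier_mat vp 1 \<and> b \<in> carrier_mat 1 vm \<and>
     (\<forall>u\<in>carrier_vec vm. Bp *\<^sub>v (A *\<^sub>v u) + a *\<^sub>v (b *\<^sub>v u) = A *\<^sub>v (Bm *\<^sub>v u)) \<and>
     (\<forall>W. invariant_subspace vm Bm W \<longrightarrow>
        (\<forall>u\<in>W. A *\<^sub>v u = 0\<^sub>v vp \<and> b *\<^sub>v u = 0\<^sub>v 1) \<longrightarrow> W = {0\<^sub>v vm}) \<and>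
     (\<forall>W. invariant_subspace vp Bp W \<longrightarrow> (\<forall>u\<in>carrier_vec vm. A *\<^sub>v u \<in> W) \<longrightarrow>
        (\<forall>c\<in>carrier_vec 1. a *\<^sub>v c \<in> W) \<longrightarrow> W = carrier_vec vp)"
  (is "?L \<longleftrightarrow> ?R")
proof (cases "A \<in> carrier_mat vp vm \<and> Bm \<in> carrier_mat vm vm \<and> Bp \<in> carrier_mat vp vp \<and>
     a \<in> carrier_mat vp 1 \<and> b \<in> carrier_mat 1 vm")
  case True
  then have A: "A \<in> carrier_mat vp vm" and Bm: "Bm \<in> carrier_mat vm vm"
    and Bp: "Bp \<in> carrier_mat vp vp" and a: "a \<in> carrier_mat vp 1" and b: "b \<in> carrier_mat 1 vm"
    by auto
  have vec: "(Bp * A - A * Bm + a * b) *\<^sub>v u =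
      Bp *\<^sub>v (A *\<^sub>v u) - A *\<^sub>v (Bm *\<^sub>v u) + a *\<^sub>v (b *\<^sub>v u)" if u: "u \<in> carrier_vec vm" for u
  proof -
    have "(Bp * A - A * Bm + a * b) *\<^sub>v u = (Bp * A) *\<^sub>v u - (A * Bm) *\<^sub>v u + (a * b) *\<^sub>v u"
      using A Bm Bp a b u
      by (subst add_mult_distrib_mat_vec[of _ vp vm], auto simp: minus_mult_distrib_mat_vec[of _ vp vm])
    then show ?thesis
      using A Bm Bp a b u by (simp add: assoc_mult_mat_vec[of _ _ _ _ vm])
  qed
  have eq: "Bp * A - A * Bm + a * b = 0\<^sub>m vp vm \<longleftrightarrow>
      (\<forall>u\<in>carrier_vec vm. Bp *\<^sub>v (A *\<^sub>v u) + a *\<^sub>v (b *\<^sub>v u) = A *\<^sub>v (Bm *\<^sub>v u))" (is "_ \<longleftrightarrow> ?V")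
  proof -
    have *: "x - y + z = 0\<^sub>v vp \<longleftrightarrow> x + z = y"
      if "x \<in> carrier_vec vp" "y \<in> carrier_vec vp" "z \<in> carrier_vec vp" for x y z :: "complex vec"
      using that by (auto simp: vec_eq_iff algebra_simps)
    have "Bp * A - A * Bm + a * b = 0\<^sub>m vp vm \<longleftrightarrow>
        (\<forall>u\<in>carrier_vec vm. (Bp * A - A * Bm + a * b) *\<^sub>v u = 0\<^sub>m vp vm *\<^sub>v u)"
      using A Bm Bp a b by (auto intro!: mat_eq_if_mult_vec_eq[of _ vp vm])
    also have "\<dots> \<longleftrightarrow> ?V"
    proof (intro ball_cong refl)
      fix u :: "complex vec" assume u: "u \<in> carrier_vec vm"
      have "0\<^sub>m vp vm *\<^sub>v u = 0\<^sub>v vp" using u by auto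
      then show "((Bp * A - A * Bm + a * b) *\<^sub>v u = 0\<^sub>m vp vm *\<^sub>v u) =
          (Bp *\<^sub>v (A *\<^sub>v u) + a *\<^sub>v (b *\<^sub>v u) = A *\<^sub>v (Bm *\<^sub>v u))"
        unfolding vec[OF u] using A Bm Bp a b u by (subst *[symmetric]) auto
    qed
    finally show ?thesis .
  qed
  have ker: "W \<subseteq> mat_kernel A \<inter> mat_kernel b \<longleftrightarrow> (\<forall>u\<in>W. A *\<^sub>v u = 0\<^sub>v vp \<and> b *\<^sub>v u = 0\<^sub>v 1)"
    if "invariant_subspace vm Bm W" for W
    using that A b unfolding invariant_subspace_iff mat_kernel[OF A] mat_kernel[OF b] by auto
  have im: "{A *\<^sub>v u + a *\<^sub>v c | u c. u \<in> carrier_vec vm \<and> c \<in> carrier_vec 1} \<subseteq> W \<longleftrightarrow>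
      (\<forall>u\<in>carrier_vec vm. A *\<^sub>v u \<in> W) \<and> (\<forall>c\<in>carrier_vec 1. a *\<^sub>v c \<in> W)" (is "?S \<subseteq> W \<longleftrightarrow> ?Q")
    if W: "invariant_subspace vp Bp W" for W
  proof
    assume S: "?S \<subseteq> W"
    have "A *\<^sub>v u \<in> W" if u: "u \<in> carrier_vec vm" for u
    proof -
      have "A *\<^sub>v u + a *\<^sub>v 0\<^sub>v 1 = A *\<^sub>v u" using A a u by (auto simp: vec_eq_iff)
      with S u show ?thesis by (smt (verit) mem_Collect_eq subsetD zero_carrier_vec)
    qed
    moreover have "a *\<^sub>v c \<in> W" if c: "c \<in> carrier_vec 1" for c
    proof -
      have "A *\<^sub>v 0\<^sub>v vm + a *\<^sub>v c = a *\<^sub>v c" using A a c by (auto simp: vec_eq_iff)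
      with S c show ?thesis by (smt (verit) mem_Collect_eq subsetD zero_carrier_vec)
    qed
    ultimately show ?Q by blast
  next
    assume ?Q
    with W show "?S \<subseteq> W" unfolding invariant_subspace_iff by auto
  qed
  have gen: "(\<nexists>W. P W \<and> W \<noteq> Z \<and> Q W) \<longleftrightarrow> (\<forall>W. P W \<longrightarrow> Q' W \<longrightarrow> W = Z)"
    if "\<And>W. P W \<Longrightarrow> Q W \<longleftrightarrow> Q' W" for P Q Q' :: "complex vec set \<Rightarrow> bool" and Z
    using that by blast
  have S1: "(\<nexists>W. invariant_subspace vm Bm W \<and> W \<noteq> {0\<^sub>v vm} \<and> W \<subseteq> mat_kernel A \<inter> mat_kernel b) \<longleftrightarrow>
      (\<forall>W. invariant_subspace vm Bm W \<longrightarrow>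
        (\<forall>u\<in>W. A *\<^sub>v u = 0\<^sub>v vp \<and> b *\<^sub>v u = 0\<^sub>v 1) \<longrightarrow> W = {0\<^sub>v vm})"
    by (rule gen[OF ker])
  have S2: "(\<nexists>W. invariant_subspace vp Bp W \<and> W \<noteq> carrier_vec vp \<and>
          {A *\<^sub>v u + a *\<^sub>v c | u c. u \<in> carrier_vec vm \<and> c \<in> carrier_vec 1} \<subseteq> W) \<longleftrightarrow>
      (\<forall>W. invariant_subspace vp Bp W \<longrightarrow> (\<forall>u\<in>carrier_vec vm. A *\<^sub>v u \<in> W) \<longrightarrow>
        (\<forall>c\<in>carrier_vec 1. a *\<^sub>v c \<in> W) \<longrightarrow> W = carrier_vec vp)"
    using gen[OF im, where Z = "carrier_vec vp"] by (simp only: imp_conjL)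
  have "?L \<longleftrightarrow> Bp * A - A * Bm + a * b = 0\<^sub>m vp vm \<and>
      \<not> (\<exists>W. invariant_subspace vm Bm W \<and> W \<noteq> {0\<^sub>v vm} \<and> W \<subseteq> mat_kernel A \<inter> mat_kernel b) \<and>
      \<not> (\<exists>W. invariant_subspace vp Bp W \<and> W \<noteq> carrier_vec vp \<and>
          {A *\<^sub>v u + a *\<^sub>v c | u c. u \<in> carrier_vec vm \<and> c \<in> carrier_vec 1} \<subseteq> W)"
    unfolding xpoint_space_def using True by simp
  also have "\<dots> \<longleftrightarrow> ?R"
    unfolding eq S1 S2 using True by simp
  finally show ?thesis .
qed (auto simp: xpoint_space_def)

section \<open>Block matrices\<close>

definition mat_direct_sum :: "'a :: zero mat \<Rightarrow> 'a mat \<Rightarrow> 'a mat" where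
  "mat_direct_sum M N =
     four_block_mat M (0\<^sub>m (dim_row M) (dim_col N)) (0\<^sub>m (dim_row N) (dim_col M)) N"

definition append_cols :: "'a :: zero mat \<Rightarrow> 'a mat \<Rightarrow> 'a mat" where
  "append_cols M N = four_block_mat M N (0\<^sub>m 0 (dim_col M)) (0\<^sub>m 0 (dim_col N))"

lemma mat_direct_sum_carrier [simp, intro]:
  "M \<in> carrier_mat n1 m1 \<Longrightarrow> N \<in> carrier_mat n2 m2 \<Longrightarrow>
     mat_direct_sum M N \<in> carrier_mat (n1 + n2) (m1 + m2)"
  unfolding mat_direct_sum_def by auto

lemma append_cols_carrier [simp, intro]:
  "M \<in> carrier_mat n m1 \<Longrightarrow> N \<in> carrier_mat n m2 \<Longrightarrow> append_cols M N \<in> carrier_mat n (m1 + m2)"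
  unfolding append_cols_def by auto

lemma mat_direct_sum_mult_vec:
  fixes M N :: "'a :: semiring_1 mat"
  assumes "M \<in> carrier_mat n1 m1" "N \<in> carrier_mat n2 m2" "u \<in> carrier_vec m1" "t \<in> carrier_vec m2"
  shows "mat_direct_sum M N *\<^sub>v (u @\<^sub>v t) = (M *\<^sub>v u) @\<^sub>v (N *\<^sub>v t)"
  using assms unfolding mat_direct_sum_def
  by (subst four_block_mat_mult_vec[of _ n1 m1 _ m2 _ n2]) auto

lemma append_cols_mult_vec:
  fixes M N :: "'a :: semiring_1 mat"
  assumes "M \<in> carrier_mat n m1" "N \<in> carrier_mat n m2" "u \<in> carrier_vec m1" "t \<in> carrier_vec m2"
  shows "append_cols M N *\<^sub>v (u @\<^sub>v t) = M *\<^sub>v u + N *\<^sub>v t"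
  using assms unfolding append_cols_def
  by (subst four_block_mat_mult_vec[of _ n m1 _ m2 _ 0]) (auto simp: vec_eq_iff)

lemma mat_direct_sum_mult:
  fixes M N :: "'a :: semiring_1 mat"
  assumes "M \<in> carrier_mat n1 m1" "N \<in> carrier_mat n2 m2"
    and "M' \<in> carrier_mat m1 k1" "N' \<in> carrier_mat m2 k2"
  shows "mat_direct_sum M N * mat_direct_sum M' N' = mat_direct_sum (M * M') (N * N')"
  using assms unfolding mat_direct_sum_def
  by (subst mult_four_block_mat[of _ n1 m1 _ m2 _ n2 _ _ k1 _ k2]) auto

lemma mat_direct_sum_add:
  fixes M N :: "'a :: monoid_add mat"
  assumes "M \<in> carrier_mat n1 m1" "N \<in> carrier_mat n2 m2"
    and "M' \<in> carrier_mat n1 m1" "N' \<in> carrier_mat n2 m2"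
  shows "mat_direct_sum M N + mat_direct_sum M' N' = mat_direct_sum (M + M') (N + N')"
  using assms unfolding mat_direct_sum_def
  by (subst add_four_block_mat[of _ n1 m1 _ m2 _ n2]) auto

lemma mat_direct_sum_uminus:
  fixes M N :: "'a :: group_add mat"
  shows "- mat_direct_sum M N = mat_direct_sum (- M) (- N)"
  unfolding mat_direct_sum_def by (rule eq_matI) auto

lemma mat_direct_sum_smult_one:
  fixes c :: "'a :: semiring_1"
  shows "mat_direct_sum (c \<cdot>\<^sub>m 1\<^sub>m n) (c \<cdot>\<^sub>m 1\<^sub>m k) = c \<cdot>\<^sub>m 1\<^sub>m (n + k)"
  unfolding mat_direct_sum_def by (rule eq_matI) auto

lemma mat_direct_sum_zero [simp]:
  "mat_direct_sum (0\<^sub>m n1 m1) (0\<^sub>m n2 m2) = 0\<^sub>m (n1 + n2) (m1 + m2)"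
  unfolding mat_direct_sum_def by simp

lemma split_vec:
  assumes "w \<in> carrier_vec (n + k)"
  obtains u t where "u \<in> carrier_vec n" "t \<in> carrier_vec k" "w = u @\<^sub>v t"
  using assms vec_first_last_append[of w n k] vec_first_carrier vec_last_carrier by metis

lemma append_zero_vec: "0\<^sub>v n @\<^sub>v 0\<^sub>v k = 0\<^sub>v (n + k)"
  by (rule eq_vecI) auto

text \<open>
  This is how the stability conditions pass from the old data to the enlarged ones: the part of an
  invariant subspace \<open>W\<close> lying in the old coordinates is an old invariant subspace, hence the old
  conditions apply to it.
\<close>

lemma invariant_subspace_slice:
  assumes W: "invariant_subspace (n + k) (mat_direct_sum M N) W"
    and M: "M \<in> carrier_mat n n" and N: "N \<in> carrier_mat k k"
  shows "invariant_subspace n M {u \<in> carrier_vec n. u @\<^sub>v 0\<^sub>v k \<in> W}"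
proof -
  have add: "(u @\<^sub>v 0\<^sub>v k) + (v @\<^sub>v 0\<^sub>v k) = (u + v) @\<^sub>v 0\<^sub>v k"
    if "u \<in> carrier_vec n" "v \<in> carrier_vec n" for u v :: "complex vec"
    using that by (simp add: append_vec_add[of _ n _ _ k])
  have smult: "c \<cdot>\<^sub>v (u @\<^sub>v 0\<^sub>v k) = (c \<cdot>\<^sub>v u) @\<^sub>v 0\<^sub>v k" for c and u :: "complex vec"
    by (rule eq_vecI) auto
  have mult: "mat_direct_sum M N *\<^sub>v (u @\<^sub>v 0\<^sub>v k) = (M *\<^sub>v u) @\<^sub>v 0\<^sub>v k" if "u \<in> carrier_vec n" for u
    using that M N by (subst mat_direct_sum_mult_vec[of _ n n _ k k]) (auto simp: vec_eq_iff)
  show ?thesis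
    using W M unfolding invariant_subspace_iff
    by (auto simp: append_zero_vec add[symmetric] smult[symmetric] mult[symmetric])
qed

section \<open>Enlarging x-point data\<close>

text \<open>
  \<open>R\<close> is the inverse of \<open>M - r\<close>; the two identities are \<open>(M - r) R = 1 = R (M - r)\<close> without subtraction.
\<close>

lemma resolvent:
  fixes M :: "complex mat"
  assumes M: "M \<in> carrier_mat n n" and r: "\<not> eigenvalue M r"
  obtains R where "R \<in> carrier_mat n n"
    and "\<And>u. u \<in> carrier_vec n \<Longrightarrow> M *\<^sub>v (R *\<^sub>v u) = r \<cdot>\<^sub>v (R *\<^sub>v u) + u"
    and "\<And>u. u \<in> carrier_vec n \<Longrightarrow> R *\<^sub>v (M *\<^sub>v u) = r \<cdot>\<^sub>v (R *\<^sub>v u) + u"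
proof -
  have C: "char_matrix M r \<in> carrier_mat n n" using M by simp
  have "det (char_matrix M r) \<noteq> 0" using r eigenvalue_det[OF M] by auto
  from det_non_zero_imp_unit[OF C this, where b = n]
  obtain R where R: "R \<in> carrier_mat n n" "R * char_matrix M r = 1\<^sub>m n" "char_matrix M r * R = 1\<^sub>m n"
    unfolding Units_def ring_mat_def by auto
  have char: "char_matrix M r *\<^sub>v u = M *\<^sub>v u - r \<cdot>\<^sub>v u" if "u \<in> carrier_vec n" for u
    using M that unfolding char_matrix_def by (auto simp: vec_eq_iff add_scalar_prod_distrib[of _ n] )
  have 1: "M *\<^sub>v (R *\<^sub>v u) = r \<cdot>\<^sub>v (R *\<^sub>v u) + u" if u: "u \<in> carrier_vec n" for u
  proof -
    have "M *\<^sub>v (R *\<^sub>v u) - r \<cdot>\<^sub>v (R *\<^sub>v u) = (char_matrix M r * R) *\<^sub>v u"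
      unfolding assoc_mult_mat_vec[OF C R(1) u] by (rule char[symmetric]) (use R u in simp)
    also have "\<dots> = u" using R u by simp
    finally show ?thesis using R u M by (auto simp: vec_eq_iff algebra_simps)
  qed
  have 2: "R *\<^sub>v (M *\<^sub>v u) = r \<cdot>\<^sub>v (R *\<^sub>v u) + u" if u: "u \<in> carrier_vec n" for u
  proof -
    have "R *\<^sub>v (M *\<^sub>v u) - r \<cdot>\<^sub>v (R *\<^sub>v u) = R *\<^sub>v (M *\<^sub>v u - r \<cdot>\<^sub>v u)"
      using R M u by (simp add: mult_minus_distrib_mat_vec[of _ n n] mult_mat_vec)
    also have "\<dots> = (R * char_matrix M r) *\<^sub>v u"
      unfolding assoc_mult_mat_vec[OF R(1) C u] char[OF u] ..
    also have "\<dots> = u" using R u by simp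
    finally show ?thesis using R u M by (auto simp: vec_eq_iff algebra_simps)
  qed
  from that R(1) 1 2 show ?thesis by blast
qed

text \<open>
  The new coordinate carries the block \<open>r\<close> of \<open>B\<^sub>x\<^sup>+\<close>; it is reached from \<open>a\<^sub>x\<close> through an entry \<open>1\<close>.
  The relation in the new coordinate reads \<open>r \<alpha> + b = \<alpha> Bm\<close> for the new row \<open>\<alpha>\<close> of \<open>A\<close>, which is
  solved by the resolvent of \<open>Bm\<close> at \<open>r\<close>. Let an invariant subspace \<open>W\<close> contain both images. The
  operator \<open>Bp \<oplus> r - r\<close> kills the new coordinate, so \<open>W\<close> contains \<open>((Bp - r) x, 0)\<close> for all
  \<open>x\<close> in the old images, and therefore for all \<open>x\<close> by the old condition. As \<open>Bp - r\<close> is onto,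
  \<open>W\<close> contains all old vectors, and the entry \<open>1\<close> supplies the new coordinate.
\<close>

lemma xpoint_extend_after:
  assumes X: "XPoint_data A Bm Bp a b \<in> xpoint_space vm vp"
    and rm: "\<not> eigenvalue Bm r" and rp: "\<not> eigenvalue Bp r"
  shows "\<exists>A' a'. XPoint_data A' Bm (mat_direct_sum Bp (r \<cdot>\<^sub>m 1\<^sub>m 1)) a' b \<in> xpoint_space vm (vp + 1)"
proof -
  from X have A: "A \<in> carrier_mat vp vm" and Bm: "Bm \<in> carrier_mat vm vm"
    and Bp: "Bp \<in> carrier_mat vp vp" and a: "a \<in> carrier_mat vp 1" and b: "b \<in> carrier_mat 1 vm"
    and eq: "\<And>u. u \<in> carrier_vec vm \<Longrightarrow> Bp *\<^sub>v (A *\<^sub>v u) + a *\<^sub>v (b *\<^sub>v u) = A *\<^sub>v (Bm *\<^sub>v u)"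
    and S1: "\<And>W. invariant_subspace vm Bm W \<Longrightarrow>
        (\<And>u. u \<in> W \<Longrightarrow> A *\<^sub>v u = 0\<^sub>v vp \<and> b *\<^sub>v u = 0\<^sub>v 1) \<Longrightarrow> W = {0\<^sub>v vm}"
    and S2: "\<And>W. invariant_subspace vp Bp W \<Longrightarrow> (\<And>u. u \<in> carrier_vec vm \<Longrightarrow> A *\<^sub>v u \<in> W) \<Longrightarrow>
        (\<And>c. c \<in> carrier_vec 1 \<Longrightarrow> a *\<^sub>v c \<in> W) \<Longrightarrow> W = carrier_vec vp"
    unfolding xpoint_space_iff by auto
  obtain Rm where Rm: "Rm \<in> carrier_mat vm vm"
    "\<And>u. u \<in> carrier_vec vm \<Longrightarrow> Rm *\<^sub>v (Bm *\<^sub>v u) = r \<cdot>\<^sub>v (Rm *\<^sub>v u) + u"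
    using resolvent[OF Bm rm] by metis
  obtain Rp where Rp: "Rp \<in> carrier_mat vp vp"
    "\<And>u. u \<in> carrier_vec vp \<Longrightarrow> Bp *\<^sub>v (Rp *\<^sub>v u) = r \<cdot>\<^sub>v (Rp *\<^sub>v u) + u"
    using resolvent[OF Bp rp] by metis
  define \<alpha> where "\<alpha> = b * Rm"
  have \<alpha>: "\<alpha> \<in> carrier_mat 1 vm" unfolding \<alpha>_def using b Rm by simp
  have \<alpha>_eq: "\<alpha> *\<^sub>v (Bm *\<^sub>v u) = r \<cdot>\<^sub>v (\<alpha> *\<^sub>v u) + b *\<^sub>v u" if u: "u \<in> carrier_vec vm" for u
    unfolding \<alpha>_def using b Rm Bm u
    by (simp add: assoc_mult_mat_vec[of _ 1 vm _ vm] mult_add_distrib_mat_vec[of _ 1 vm] mult_mat_vec)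
  define r1 where "r1 = r \<cdot>\<^sub>m 1\<^sub>m 1"
  have r1: "r1 \<in> carrier_mat 1 1" and r1_mult: "\<And>t. t \<in> carrier_vec 1 \<Longrightarrow> r1 *\<^sub>v t = r \<cdot>\<^sub>v t"
    unfolding r1_def by (auto simp: vec_eq_iff)
  define A' where "A' = A @\<^sub>r \<alpha>"
  define a' where "a' = a @\<^sub>r 1\<^sub>m 1"
  define B' where "B' = mat_direct_sum Bp r1"
  have carr: "A' \<in> carrier_mat (vp + 1) vm" "a' \<in> carrier_mat (vp + 1) 1"
    "B' \<in> carrier_mat (vp + 1) (vp + 1)"
    unfolding A'_def a'_def B'_def using A \<alpha> a Bp r1 by (auto simp del: One_nat_def)
  have A'v: "A' *\<^sub>v u = (A *\<^sub>v u) @\<^sub>v (\<alpha> *\<^sub>v u)" if "u \<in> carrier_vec vm" for u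
    unfolding A'_def using mat_mult_append[OF A \<alpha> that] .
  have a'v: "a' *\<^sub>v c = (a *\<^sub>v c) @\<^sub>v c" if "c \<in> carrier_vec 1" for c
    unfolding a'_def using mat_mult_append[OF a one_carrier_mat that] that by simp
  have B'v: "B' *\<^sub>v (x @\<^sub>v t) = (Bp *\<^sub>v x) @\<^sub>v (r \<cdot>\<^sub>v t)"
    if "x \<in> carrier_vec vp" "t \<in> carrier_vec 1" for x t
    unfolding B'_def using mat_direct_sum_mult_vec[OF Bp r1 that] that by (simp add: r1_mult)
  have "XPoint_data A' Bm B' a' b \<in> xpoint_space vm (vp + 1)"
    unfolding xpoint_space_iff
  proof (intro conjI ballI allI impI)
    fix u :: "complex vec" assume u: "u \<in> carrier_vec vm"
    have "B' *\<^sub>v (A' *\<^sub>v u) + a' *\<^sub>v (b *\<^sub>v u) =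
        ((Bp *\<^sub>v (A *\<^sub>v u)) @\<^sub>v (r \<cdot>\<^sub>v (\<alpha> *\<^sub>v u))) + ((a *\<^sub>v (b *\<^sub>v u)) @\<^sub>v (b *\<^sub>v u))"
      using u A \<alpha> b by (simp add: A'v B'v a'v del: One_nat_def)
    also have "\<dots> = (A *\<^sub>v (Bm *\<^sub>v u)) @\<^sub>v (\<alpha> *\<^sub>v (Bm *\<^sub>v u))"
      using u A \<alpha> b a Bp by (simp add: append_vec_add[of _ vp _ _ 1] eq \<alpha>_eq del: One_nat_def)
    finally show "B' *\<^sub>v (A' *\<^sub>v u) + a' *\<^sub>v (b *\<^sub>v u) = A' *\<^sub>v (Bm *\<^sub>v u)"
      using u Bm by (simp add: A'v)
  next
    fix W assume W: "invariant_subspace vm Bm W"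
      and ker: "\<forall>u\<in>W. A' *\<^sub>v u = 0\<^sub>v (vp + 1) \<and> b *\<^sub>v u = 0\<^sub>v 1"
    show "W = {0\<^sub>v vm}"
    proof (rule S1[OF W])
      fix u assume u: "u \<in> W"
      with W have uc: "u \<in> carrier_vec vm" unfolding invariant_subspace_iff by auto
      have "(A *\<^sub>v u) @\<^sub>v (\<alpha> *\<^sub>v u) = 0\<^sub>v vp @\<^sub>v 0\<^sub>v 1"
        using ker u A'v[OF uc] by (simp add: append_zero_vec)
      then show "A *\<^sub>v u = 0\<^sub>v vp \<and> b *\<^sub>v u = 0\<^sub>v 1"
        using ker u uc A append_vec_eq[of "A *\<^sub>v u" vp "0\<^sub>v vp"] by auto
    qed
  next
    fix W assume W: "invariant_subspace (vp + 1) B' W"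
      and imA: "\<forall>u\<in>carrier_vec vm. A' *\<^sub>v u \<in> W"
      and ima: "\<forall>c\<in>carrier_vec 1. a' *\<^sub>v c \<in> W"
    have Wadd: "u + v \<in> W" if "u \<in> W" "v \<in> W" for u v
      using W that unfolding invariant_subspace_iff by auto
    have Wsmult: "c \<cdot>\<^sub>v u \<in> W" if "u \<in> W" for u c
      using W that unfolding invariant_subspace_iff by auto
    have WB: "B' *\<^sub>v u \<in> W" if "u \<in> W" for u
      using W that unfolding invariant_subspace_iff by auto
    define U where "U = {x \<in> carrier_vec vp. x @\<^sub>v 0\<^sub>v 1 \<in> W}"
    have U: "invariant_subspace vp Bp U"
      unfolding U_def using invariant_subspace_slice[OF W[unfolded B'_def] Bp r1] .
    have shift: "Bp *\<^sub>v x + (- r) \<cdot>\<^sub>v x \<in> U"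
      if "x @\<^sub>v t \<in> W" "x \<in> carrier_vec vp" "t \<in> carrier_vec 1" for x t
    proof -
      have "B' *\<^sub>v (x @\<^sub>v t) + (- r) \<cdot>\<^sub>v (x @\<^sub>v t) = (Bp *\<^sub>v x + (- r) \<cdot>\<^sub>v x) @\<^sub>v 0\<^sub>v 1"
        unfolding B'v[OF that(2,3)] using that Bp by (intro eq_vecI) auto
      then show ?thesis using Wadd[OF WB[OF that(1)] Wsmult[OF that(1), of "- r"]] that Bp
        unfolding U_def by auto
    qed
    \<comment> \<open>The old condition is applied to the preimage of \<open>U\<close> under \<open>Bp - r\<close>, because \<open>W\<close> gives
      information on the images of \<open>A\<close> and \<open>a\<close> only after \<open>Bp - r\<close> has been applied.\<close>
    define V where "V = {x \<in> carrier_vec vp. Bp *\<^sub>v x + (- r) \<cdot>\<^sub>v x \<in> U}"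
    have "invariant_subspace vp Bp V"
    proof -
      have "Bp *\<^sub>v (x + y) + (- r) \<cdot>\<^sub>v (x + y) = (Bp *\<^sub>v x + (- r) \<cdot>\<^sub>v x) + (Bp *\<^sub>v y + (- r) \<cdot>\<^sub>v y)"
        if "x \<in> carrier_vec vp" "y \<in> carrier_vec vp" for x y
        using that Bp by (subst mult_add_distrib_mat_vec[OF Bp]) (auto simp: vec_eq_iff algebra_simps)
      moreover have "Bp *\<^sub>v (c \<cdot>\<^sub>v x) + (- r) \<cdot>\<^sub>v (c \<cdot>\<^sub>v x) = c \<cdot>\<^sub>v (Bp *\<^sub>v x + (- r) \<cdot>\<^sub>v x)"
        if "x \<in> carrier_vec vp" for x c
        using that Bp by (auto simp: vec_eq_iff algebra_simps)
      moreover have "Bp *\<^sub>v (Bp *\<^sub>v x) + (- r) \<cdot>\<^sub>v (Bp *\<^sub>v x) = Bp *\<^sub>v (Bp *\<^sub>v x + (- r) \<cdot>\<^sub>v x)"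
        if "x \<in> carrier_vec vp" for x
        using that Bp by (subst mult_add_distrib_mat_vec[OF Bp]) (auto simp: mult_mat_vec)
      moreover have "Bp *\<^sub>v 0\<^sub>v vp + (- r) \<cdot>\<^sub>v 0\<^sub>v vp = 0\<^sub>v vp" using Bp by (auto simp: vec_eq_iff)
      ultimately show ?thesis
        using U Bp unfolding invariant_subspace_iff V_def by auto
    qed
    then have "V = carrier_vec vp"
    proof (rule S2)
      fix u :: "complex vec" assume u: "u \<in> carrier_vec vm"
      then show "A *\<^sub>v u \<in> V"
        using imA A'v[OF u] A \<alpha> shift[of "A *\<^sub>v u" "\<alpha> *\<^sub>v u"] unfolding V_def by auto
    next
      fix c :: "complex vec" assume c: "c \<in> carrier_vec 1"
      then show "a *\<^sub>v c \<in> V"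
        using ima a'v[OF c] a shift[of "a *\<^sub>v c" c] unfolding V_def by auto
    qed
    have U_top: "z \<in> U" if z: "z \<in> carrier_vec vp" for z
    proof -
      have "Rp *\<^sub>v z \<in> V" using \<open>V = carrier_vec vp\<close> Rp z by auto
      then have "Bp *\<^sub>v (Rp *\<^sub>v z) + (- r) \<cdot>\<^sub>v (Rp *\<^sub>v z) \<in> U" unfolding V_def by auto
      moreover have "Bp *\<^sub>v (Rp *\<^sub>v z) + (- r) \<cdot>\<^sub>v (Rp *\<^sub>v z) = z"
        unfolding Rp(2)[OF z] using Rp(1) z by (intro eq_vecI) auto
      ultimately show ?thesis by simp
    qed
    have "w \<in> W" if "w \<in> carrier_vec (vp + 1)" for w
    proof -
      from that obtain z c where z: "z \<in> carrier_vec vp" and c: "c \<in> carrier_vec 1" and w: "w = z @\<^sub>v c"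
        by (rule split_vec)
      have "z + (-1) \<cdot>\<^sub>v (a *\<^sub>v c) \<in> U" using U_top z c a by simp
      then have "(z + (-1) \<cdot>\<^sub>v (a *\<^sub>v c)) @\<^sub>v 0\<^sub>v 1 \<in> W" unfolding U_def by auto
      moreover have "(a *\<^sub>v c) @\<^sub>v c \<in> W" using ima a'v[OF c] c by auto
      ultimately have "((z + (-1) \<cdot>\<^sub>v (a *\<^sub>v c)) @\<^sub>v 0\<^sub>v 1) + ((a *\<^sub>v c) @\<^sub>v c) \<in> W" by (rule Wadd)
      also have "((z + (-1) \<cdot>\<^sub>v (a *\<^sub>v c)) @\<^sub>v 0\<^sub>v 1) + ((a *\<^sub>v c) @\<^sub>v c) = w"
        unfolding w using z c a by (intro eq_vecI) auto
      finally show ?thesis .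
    qed
    moreover have "W \<subseteq> carrier_vec (vp + 1)" using W unfolding invariant_subspace_iff by auto
    ultimately show "W = carrier_vec (vp + 1)" by auto
  qed (use A Bm b carr in auto)
  then show ?thesis unfolding B'_def r1_def by blast
qed

text \<open>
  The dual construction: the new coordinate is seen by \<open>b\<^sub>x\<close> through an entry \<open>1\<close>, and the new
  column \<open>\<beta>\<close> of \<open>A\<close> has to satisfy \<open>(Bp - r) \<beta> = - a\<close>. If \<open>(u, t)\<close> lies in an invariant subspace
  contained in both kernels, then so does \<open>((Bm - r) u, 0)\<close>, which the old condition forces to
  vanish; hence \<open>u = 0\<close>, and then \<open>t = 0\<close> because \<open>b\<^sub>x\<close> sees \<open>t\<close>.
\<close>

lemma xpoint_extend_before:
  assumes X: "XPoint_data A Bm Bp a b \<in> xpoint_space vm vp"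
    and rm: "\<not> eigenvalue Bm r" and rp: "\<not> eigenvalue Bp r"
  shows "\<exists>A' b'. XPoint_data A' (mat_direct_sum Bm (r \<cdot>\<^sub>m 1\<^sub>m 1)) Bp a b' \<in> xpoint_space (vm + 1) vp"
proof -
  from X have A: "A \<in> carrier_mat vp vm" and Bm: "Bm \<in> carrier_mat vm vm"
    and Bp: "Bp \<in> carrier_mat vp vp" and a: "a \<in> carrier_mat vp 1" and b: "b \<in> carrier_mat 1 vm"
    and eq: "\<And>u. u \<in> carrier_vec vm \<Longrightarrow> Bp *\<^sub>v (A *\<^sub>v u) + a *\<^sub>v (b *\<^sub>v u) = A *\<^sub>v (Bm *\<^sub>v u)"
    and S1: "\<And>W. invariant_subspace vm Bm W \<Longrightarrow>
        (\<And>u. u \<in> W \<Longrightarrow> A *\<^sub>v u = 0\<^sub>v vp \<and> b *\<^sub>v u = 0\<^sub>v 1) \<Longrightarrow> W = {0\<^sub>v vm}"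
    and S2: "\<And>W. invariant_subspace vp Bp W \<Longrightarrow> (\<And>u. u \<in> carrier_vec vm \<Longrightarrow> A *\<^sub>v u \<in> W) \<Longrightarrow>
        (\<And>c. c \<in> carrier_vec 1 \<Longrightarrow> a *\<^sub>v c \<in> W) \<Longrightarrow> W = carrier_vec vp"
    unfolding xpoint_space_iff by auto
  obtain Rp where Rp: "Rp \<in> carrier_mat vp vp"
    "\<And>u. u \<in> carrier_vec vp \<Longrightarrow> Bp *\<^sub>v (Rp *\<^sub>v u) = r \<cdot>\<^sub>v (Rp *\<^sub>v u) + u"
    using resolvent[OF Bp rp] by metis
  define \<beta> where "\<beta> = - (Rp * a)"
  have \<beta>: "\<beta> \<in> carrier_mat vp 1" unfolding \<beta>_def using a Rp by simp
  have \<beta>_eq: "Bp *\<^sub>v (\<beta> *\<^sub>v t) + a *\<^sub>v t = r \<cdot>\<^sub>v (\<beta> *\<^sub>v t)" if t: "t \<in> carrier_vec 1" for t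
  proof -
    have *: "\<beta> *\<^sub>v t = (-1) \<cdot>\<^sub>v (Rp *\<^sub>v (a *\<^sub>v t))"
      unfolding \<beta>_def assoc_mult_mat_vec[OF Rp(1) a t, symmetric] using a Rp t by (auto simp: vec_eq_iff)
    show ?thesis
      unfolding * using Rp a t Bp by (auto simp: mult_mat_vec vec_eq_iff algebra_simps)
  qed
  define r1 where "r1 = r \<cdot>\<^sub>m 1\<^sub>m 1"
  have r1: "r1 \<in> carrier_mat 1 1" and r1_mult: "\<And>t. t \<in> carrier_vec 1 \<Longrightarrow> r1 *\<^sub>v t = r \<cdot>\<^sub>v t"
    unfolding r1_def by (auto simp: vec_eq_iff)
  define A' where "A' = append_cols A \<beta>"
  define b' where "b' = append_cols b (1\<^sub>m 1)"
  define B' where "B' = mat_direct_sum Bm r1"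
  have carr: "A' \<in> carrier_mat vp (vm + 1)" "b' \<in> carrier_mat 1 (vm + 1)"
    "B' \<in> carrier_mat (vm + 1) (vm + 1)"
    unfolding A'_def b'_def B'_def using A \<beta> b Bm r1 by (auto simp del: One_nat_def)
  have A'v: "A' *\<^sub>v (u @\<^sub>v t) = A *\<^sub>v u + \<beta> *\<^sub>v t" if "u \<in> carrier_vec vm" "t \<in> carrier_vec 1" for u t
    unfolding A'_def using append_cols_mult_vec[OF A \<beta> that] .
  have b'v: "b' *\<^sub>v (u @\<^sub>v t) = b *\<^sub>v u + t" if "u \<in> carrier_vec vm" "t \<in> carrier_vec 1" for u t
    unfolding b'_def using append_cols_mult_vec[OF b one_carrier_mat that] that by simp
  have B'v: "B' *\<^sub>v (u @\<^sub>v t) = (Bm *\<^sub>v u) @\<^sub>v (r \<cdot>\<^sub>v t)"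
    if "u \<in> carrier_vec vm" "t \<in> carrier_vec 1" for u t
    unfolding B'_def using mat_direct_sum_mult_vec[OF Bm r1 that] that by (simp add: r1_mult)
  have "XPoint_data A' B' Bp a b' \<in> xpoint_space (vm + 1) vp"
    unfolding xpoint_space_iff
  proof (intro conjI ballI allI impI)
    fix w :: "complex vec" assume "w \<in> carrier_vec (vm + 1)"
    then obtain u t where u: "u \<in> carrier_vec vm" and t: "t \<in> carrier_vec 1" and w: "w = u @\<^sub>v t"
      by (rule split_vec)
    have "Bp *\<^sub>v (A' *\<^sub>v w) + a *\<^sub>v (b' *\<^sub>v w) =
        (Bp *\<^sub>v (A *\<^sub>v u) + Bp *\<^sub>v (\<beta> *\<^sub>v t)) + (a *\<^sub>v (b *\<^sub>v u) + a *\<^sub>v t)"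
      unfolding w A'v[OF u t] b'v[OF u t] using u t A b a Bp \<beta>
      by (simp add: mult_add_distrib_mat_vec[of _ vp vp] mult_add_distrib_mat_vec[of _ vp 1])
    also have "\<dots> = (Bp *\<^sub>v (A *\<^sub>v u) + a *\<^sub>v (b *\<^sub>v u)) + (Bp *\<^sub>v (\<beta> *\<^sub>v t) + a *\<^sub>v t)"
      using u t A b a Bp \<beta> by (auto simp: vec_eq_iff)
    also have "\<dots> = A *\<^sub>v (Bm *\<^sub>v u) + \<beta> *\<^sub>v (r \<cdot>\<^sub>v t)"
      unfolding eq[OF u] \<beta>_eq[OF t] using \<beta> t by (simp add: mult_mat_vec)
    finally show "Bp *\<^sub>v (A' *\<^sub>v w) + a *\<^sub>v (b' *\<^sub>v w) = A' *\<^sub>v (B' *\<^sub>v w)"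
      unfolding w B'v[OF u t] using u t Bm by (simp add: A'v)
  next
    fix W assume W: "invariant_subspace (vm + 1) B' W"
      and ker: "\<forall>w\<in>W. A' *\<^sub>v w = 0\<^sub>v vp \<and> b' *\<^sub>v w = 0\<^sub>v 1"
    have Wadd: "u + v \<in> W" if "u \<in> W" "v \<in> W" for u v
      using W that unfolding invariant_subspace_iff by auto
    have Wsmult: "c \<cdot>\<^sub>v u \<in> W" if "u \<in> W" for u c
      using W that unfolding invariant_subspace_iff by auto
    have WB: "B' *\<^sub>v u \<in> W" if "u \<in> W" for u
      using W that unfolding invariant_subspace_iff by auto
    define U where "U = {u \<in> carrier_vec vm. u @\<^sub>v 0\<^sub>v 1 \<in> W}"
    have U: "invariant_subspace vm Bm U"
      unfolding U_def using invariant_subspace_slice[OF W[unfolded B'_def] Bm r1] .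
    have U0: "U = {0\<^sub>v vm}"
    proof (rule S1[OF U])
      fix u assume "u \<in> U"
      then have u: "u \<in> carrier_vec vm" and uW: "u @\<^sub>v 0\<^sub>v 1 \<in> W" unfolding U_def by auto
      have "A' *\<^sub>v (u @\<^sub>v 0\<^sub>v 1) = A *\<^sub>v u" "b' *\<^sub>v (u @\<^sub>v 0\<^sub>v 1) = b *\<^sub>v u"
        using A'v[OF u zero_carrier_vec] b'v[OF u zero_carrier_vec] u A b \<beta> by auto
      with ker uW show "A *\<^sub>v u = 0\<^sub>v vp \<and> b *\<^sub>v u = 0\<^sub>v 1" by auto
    qed
    have "w = 0\<^sub>v (vm + 1)" if w: "w \<in> W" for w
    proof -
      have "w \<in> carrier_vec (vm + 1)" using W w unfolding invariant_subspace_iff by auto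
      then obtain u t where u: "u \<in> carrier_vec vm" and t: "t \<in> carrier_vec 1" and w': "w = u @\<^sub>v t"
        by (rule split_vec)
      have "B' *\<^sub>v w + (- r) \<cdot>\<^sub>v w = (Bm *\<^sub>v u + (- r) \<cdot>\<^sub>v u) @\<^sub>v 0\<^sub>v 1"
        unfolding w' B'v[OF u t] using u t Bm by (intro eq_vecI) auto
      then have "Bm *\<^sub>v u + (- r) \<cdot>\<^sub>v u \<in> U"
        using Wadd[OF WB[OF w] Wsmult[OF w, of "- r"]] u Bm unfolding U_def by auto
      then have "Bm *\<^sub>v u + (- r) \<cdot>\<^sub>v u = 0\<^sub>v vm" using U0 by auto
      then have "Bm *\<^sub>v u = r \<cdot>\<^sub>v u" using u Bm by (auto simp: vec_eq_iff)
      then have u0: "u = 0\<^sub>v vm" using rm u Bm unfolding eigenvalue_def eigenvector_def by auto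
      have "b' *\<^sub>v w = 0\<^sub>v 1" using ker w by auto
      moreover have "b *\<^sub>v u = 0\<^sub>v 1" using b unfolding u0 by (intro eq_vecI) auto
      ultimately have "t = 0\<^sub>v 1" using b'v[OF u t] t w' by simp
      then show ?thesis using u0 w' by (simp add: append_zero_vec)
    qed
    moreover have "0\<^sub>v (vm + 1) \<in> W" using W unfolding invariant_subspace_iff by auto
    ultimately show "W = {0\<^sub>v (vm + 1)}" by blast
  next
    fix W assume W: "invariant_subspace vp Bp W"
      and imA: "\<forall>u\<in>carrier_vec (vm + 1). A' *\<^sub>v u \<in> W" and ima: "\<forall>c\<in>carrier_vec 1. a *\<^sub>v c \<in> W"
    show "W = carrier_vec vp"
    proof (rule S2[OF W])
      fix u :: "complex vec" assume u: "u \<in> carrier_vec vm"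
      have "A' *\<^sub>v (u @\<^sub>v 0\<^sub>v 1) = A *\<^sub>v u" using A'v[OF u zero_carrier_vec] u A \<beta> by auto
      then show "A *\<^sub>v u \<in> W" using imA u by (metis append_carrier_vec zero_carrier_vec)
    qed (use ima in auto)
  qed (use A Bp a carr in auto)
  then show ?thesis unfolding B'_def r1_def by blast
qed

text \<open>
  With \<open>A = 1\<close> on the new coordinates both stability conditions are automatic there: nothing new lies
  in the kernel of \<open>A\<close>, and everything new lies in its image.
\<close>

lemma xpoint_pad:
  assumes X: "XPoint_data A Bm Bp a b \<in> xpoint_space vm vp"
  shows "XPoint_data (mat_direct_sum A (1\<^sub>m k)) (mat_direct_sum Bm (0\<^sub>m k k))
      (mat_direct_sum Bp (0\<^sub>m k k)) (a @\<^sub>r 0\<^sub>m k 1) (append_cols b (0\<^sub>m 1 k))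
    \<in> xpoint_space (vm + k) (vp + k)"
proof -
  from X have A: "A \<in> carrier_mat vp vm" and Bm: "Bm \<in> carrier_mat vm vm"
    and Bp: "Bp \<in> carrier_mat vp vp" and a: "a \<in> carrier_mat vp 1" and b: "b \<in> carrier_mat 1 vm"
    and eq: "\<And>u. u \<in> carrier_vec vm \<Longrightarrow> Bp *\<^sub>v (A *\<^sub>v u) + a *\<^sub>v (b *\<^sub>v u) = A *\<^sub>v (Bm *\<^sub>v u)"
    and S1: "\<And>W. invariant_subspace vm Bm W \<Longrightarrow>
        (\<And>u. u \<in> W \<Longrightarrow> A *\<^sub>v u = 0\<^sub>v vp \<and> b *\<^sub>v u = 0\<^sub>v 1) \<Longrightarrow> W = {0\<^sub>v vm}"
    and S2: "\<And>W. invariant_subspace vp Bp W \<Longrightarrow> (\<And>u. u \<in> carrier_vec vm \<Longrightarrow> A *\<^sub>v u \<in> W) \<Longrightarrow>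
        (\<And>c. c \<in> carrier_vec 1 \<Longrightarrow> a *\<^sub>v c \<in> W) \<Longrightarrow> W = carrier_vec vp"
    unfolding xpoint_space_iff by auto
  define Z :: "complex mat" where "Z = 0\<^sub>m k k"
  have Z: "Z \<in> carrier_mat k k" and Zv: "\<And>t. t \<in> carrier_vec k \<Longrightarrow> Z *\<^sub>v t = 0\<^sub>v k"
    unfolding Z_def by auto
  define A' where "A' = mat_direct_sum A (1\<^sub>m k)"
  define Bm' where "Bm' = mat_direct_sum Bm Z"
  define Bp' where "Bp' = mat_direct_sum Bp Z"
  define a' where "a' = a @\<^sub>r 0\<^sub>m k 1"
  define b' where "b' = append_cols b (0\<^sub>m 1 k)"
  have carr: "A' \<in> carrier_mat (vp + k) (vm + k)" "Bm' \<in> carrier_mat (vm + k) (vm + k)"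
    "Bp' \<in> carrier_mat (vp + k) (vp + k)" "a' \<in> carrier_mat (vp + k) 1" "b' \<in> carrier_mat 1 (vm + k)"
    unfolding A'_def a'_def Bm'_def Bp'_def b'_def using A Bm Bp a b Z by auto
  have A'v: "A' *\<^sub>v (u @\<^sub>v t) = (A *\<^sub>v u) @\<^sub>v t" if "u \<in> carrier_vec vm" "t \<in> carrier_vec k" for u t
    unfolding A'_def using mat_direct_sum_mult_vec[OF A one_carrier_mat that] that by simp
  have Bm'v: "Bm' *\<^sub>v (u @\<^sub>v t) = (Bm *\<^sub>v u) @\<^sub>v 0\<^sub>v k"
    if "u \<in> carrier_vec vm" "t \<in> carrier_vec k" for u t
    unfolding Bm'_def using mat_direct_sum_mult_vec[OF Bm Z that] that by (simp add: Zv)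
  have Bp'v: "Bp' *\<^sub>v (u @\<^sub>v t) = (Bp *\<^sub>v u) @\<^sub>v 0\<^sub>v k"
    if "u \<in> carrier_vec vp" "t \<in> carrier_vec k" for u t
    unfolding Bp'_def using mat_direct_sum_mult_vec[OF Bp Z that] that by (simp add: Zv)
  have a'v: "a' *\<^sub>v c = (a *\<^sub>v c) @\<^sub>v 0\<^sub>v k" if "c \<in> carrier_vec 1" for c
  proof -
    have "0\<^sub>m k 1 *\<^sub>v c = 0\<^sub>v k" using that by (intro eq_vecI) auto
    then show ?thesis unfolding a'_def using mat_mult_append[OF a zero_carrier_mat[of k 1] that] by simp
  qed
  have b'v: "b' *\<^sub>v (u @\<^sub>v t) = b *\<^sub>v u" if "u \<in> carrier_vec vm" "t \<in> carrier_vec k" for u t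
  proof -
    have "0\<^sub>m 1 k *\<^sub>v t = 0\<^sub>v 1" using that by (intro eq_vecI) auto
    then show ?thesis
      unfolding b'_def using append_cols_mult_vec[OF b zero_carrier_mat that] that b by simp
  qed
  have "XPoint_data A' Bm' Bp' a' b' \<in> xpoint_space (vm + k) (vp + k)"
    unfolding xpoint_space_iff
  proof (intro conjI ballI allI impI)
    fix w :: "complex vec" assume "w \<in> carrier_vec (vm + k)"
    then obtain u t where u: "u \<in> carrier_vec vm" and t: "t \<in> carrier_vec k" and w: "w = u @\<^sub>v t"
      by (rule split_vec)
    have "Bp' *\<^sub>v (A' *\<^sub>v w) + a' *\<^sub>v (b' *\<^sub>v w) =
        ((Bp *\<^sub>v (A *\<^sub>v u)) @\<^sub>v 0\<^sub>v k) + ((a *\<^sub>v (b *\<^sub>v u)) @\<^sub>v 0\<^sub>v k)"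
      unfolding w using u t A b by (simp add: A'v Bp'v b'v a'v)
    also have "\<dots> = (A *\<^sub>v (Bm *\<^sub>v u)) @\<^sub>v 0\<^sub>v k"
      using u A a b Bp by (simp add: append_vec_add[of _ vp _ _ k] eq)
    finally show "Bp' *\<^sub>v (A' *\<^sub>v w) + a' *\<^sub>v (b' *\<^sub>v w) = A' *\<^sub>v (Bm' *\<^sub>v w)"
      unfolding w using u t Bm by (simp add: Bm'v A'v)
  next
    fix W assume W: "invariant_subspace (vm + k) Bm' W"
      and ker: "\<forall>w\<in>W. A' *\<^sub>v w = 0\<^sub>v (vp + k) \<and> b' *\<^sub>v w = 0\<^sub>v 1"
    have split: "\<exists>u \<in> carrier_vec vm. w = u @\<^sub>v 0\<^sub>v k \<and> A *\<^sub>v u = 0\<^sub>v vp \<and> b *\<^sub>v u = 0\<^sub>v 1"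
      if w: "w \<in> W" for w
    proof -
      have "w \<in> carrier_vec (vm + k)" using W w unfolding invariant_subspace_iff by auto
      then obtain u t where u: "u \<in> carrier_vec vm" and t: "t \<in> carrier_vec k" and w': "w = u @\<^sub>v t"
        by (rule split_vec)
      have "(A *\<^sub>v u) @\<^sub>v t = 0\<^sub>v vp @\<^sub>v 0\<^sub>v k"
        using ker w A'v[OF u t] by (simp add: w' append_zero_vec)
      then have "A *\<^sub>v u = 0\<^sub>v vp" "t = 0\<^sub>v k"
        using append_vec_eq[of "A *\<^sub>v u" vp "0\<^sub>v vp"] A u by auto
      moreover have "b *\<^sub>v u = 0\<^sub>v 1" using ker w b'v[OF u t] by (simp add: w')
      ultimately show ?thesis using u w' by auto
    qed
    define U where "U = {u \<in> carrier_vec vm. u @\<^sub>v 0\<^sub>v k \<in> W}"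
    have U: "invariant_subspace vm Bm U"
      unfolding U_def using invariant_subspace_slice[OF W[unfolded Bm'_def] Bm Z] .
    have U0: "U = {0\<^sub>v vm}"
    proof (rule S1[OF U])
      fix u assume "u \<in> U"
      then have u: "u \<in> carrier_vec vm" and uW: "u @\<^sub>v 0\<^sub>v k \<in> W" unfolding U_def by auto
      from split[OF uW] u show "A *\<^sub>v u = 0\<^sub>v vp \<and> b *\<^sub>v u = 0\<^sub>v 1"
        using append_vec_eq[of u vm] by auto
    qed
    have "w = 0\<^sub>v (vm + k)" if "w \<in> W" for w
    proof -
      from split[OF that] obtain u where u: "u \<in> carrier_vec vm" "w = u @\<^sub>v 0\<^sub>v k" by auto
      with that have "u \<in> U" unfolding U_def by simp
      with U0 u show ?thesis by (simp add: append_zero_vec)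
    qed
    moreover have "0\<^sub>v (vm + k) \<in> W" using W unfolding invariant_subspace_iff by auto
    ultimately show "W = {0\<^sub>v (vm + k)}" by blast
  next
    fix W assume W: "invariant_subspace (vp + k) Bp' W"
      and imA: "\<forall>u\<in>carrier_vec (vm + k). A' *\<^sub>v u \<in> W" and ima: "\<forall>c\<in>carrier_vec 1. a' *\<^sub>v c \<in> W"
    define U where "U = {u \<in> carrier_vec vp. u @\<^sub>v 0\<^sub>v k \<in> W}"
    have U: "invariant_subspace vp Bp U"
      unfolding U_def using invariant_subspace_slice[OF W[unfolded Bp'_def] Bp Z] .
    have U1: "U = carrier_vec vp"
    proof (rule S2[OF U])
      fix u :: "complex vec" assume u: "u \<in> carrier_vec vm"
      have "A' *\<^sub>v (u @\<^sub>v 0\<^sub>v k) \<in> W" using imA u by (metis append_carrier_vec zero_carrier_vec)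
      then show "A *\<^sub>v u \<in> U" using A'v[OF u] A u unfolding U_def by auto
    next
      fix c :: "complex vec" assume c: "c \<in> carrier_vec 1"
      then show "a *\<^sub>v c \<in> U" using ima a'v[OF c] a unfolding U_def by auto
    qed
    have "w \<in> W" if "w \<in> carrier_vec (vp + k)" for w
    proof -
      from that obtain u t where u: "u \<in> carrier_vec vp" and t: "t \<in> carrier_vec k" and w: "w = u @\<^sub>v t"
        by (rule split_vec)
      have "A' *\<^sub>v (0\<^sub>v vm @\<^sub>v t) \<in> W" using imA t by (metis append_carrier_vec zero_carrier_vec)
      moreover have "A' *\<^sub>v (0\<^sub>v vm @\<^sub>v t) = 0\<^sub>v vp @\<^sub>v t"
        using A t by (simp add: A'v) (auto simp: vec_eq_iff)
      moreover have "u @\<^sub>v 0\<^sub>v k \<in> W" using U1 u unfolding U_def by auto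
      ultimately have "(u @\<^sub>v 0\<^sub>v k) + (0\<^sub>v vp @\<^sub>v t) \<in> W" using W unfolding invariant_subspace_iff by auto
      also have "(u @\<^sub>v 0\<^sub>v k) + (0\<^sub>v vp @\<^sub>v t) = w"
        unfolding w using u t by (intro eq_vecI) auto
      finally show ?thesis .
    qed
    moreover have "W \<subseteq> carrier_vec (vp + k)" using W unfolding invariant_subspace_iff by auto
    ultimately show "W = carrier_vec (vp + k)" by auto
  qed (use carr in auto)
  then show ?thesis unfolding A'_def Bm'_def Bp'_def a'_def b'_def Z_def .
qed

section \<open>Enlarging points of a fibre of the moment map\<close>

lemma moment_fiber_iff:
  "m \<in> moment_fiber B v lam \<longleftrightarrow> m \<in> Mtilde B v \<and>
     (\<forall>\<zeta> < length B. contrib_after (m \<zeta>) + contrib_before (m (next_elt B \<zeta>)) = param B v lam \<zeta>)"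
proof -
  have "moment_map B m = param B v lam \<longleftrightarrow>
      (\<forall>\<zeta>\<in>{..<length B}. moment_map B m \<zeta> = param B v lam \<zeta>)"
    by (auto simp: fun_eq_iff moment_map_def param_def)
  then show ?thesis unfolding moment_fiber_def by (auto simp: moment_map_def)
qed

lemma seg_before_less: "B \<noteq> [] \<Longrightarrow> seg_before B i < length B"
  unfolding seg_before_def by simp

lemma seg_before_Suc: "Suc i < length B \<Longrightarrow> seg_before B (Suc i) = i"
  unfolding seg_before_def by simp

lemma seg_before_0: "B \<noteq> [] \<Longrightarrow> seg_before B 0 = length B - 1"
  unfolding seg_before_def by simp

lemma next_elt_seg_before: "i < length B \<Longrightarrow> next_elt B (seg_before B i) = i"
  by (cases i) (auto simp: seg_before_Suc seg_before_0 next_elt_def)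

lemma seg_before_next_elt:
  assumes "\<zeta> < length B" shows "seg_before B (next_elt B \<zeta>) = \<zeta>"
proof (cases "Suc \<zeta> < length B")
  case True then show ?thesis by (simp add: next_elt_def seg_before_Suc)
next
  case False
  with assms have "Suc \<zeta> = length B" by simp
  moreover from assms have "B \<noteq> []" by auto
  ultimately show ?thesis using seg_before_0[of B] by (simp add: next_elt_def)
qed

lemma next_elt_less: "B \<noteq> [] \<Longrightarrow> next_elt B \<zeta> < length B"
  unfolding next_elt_def by simp

text \<open>
  All new blocks entering the moment map are zero, which is why the parameter has to be zero here: a
  parameter \<open>\<lambda>\<close> would ask for \<open>\<lambda>\<close> on the new coordinates. The increments may differ between the
  two ends of an arrow, where zero maps of any shape are available, but not across an x-point, where
  the new part of \<open>A\<close> is an identity.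
\<close>

lemma moment_fiber_pad:
  assumes ne: "B \<noteq> []" and fib: "moment_fiber B v (\<lambda>\<sigma>. 0) \<noteq> {}"
    and len: "length v = length B" "length v' = length B"
    and le: "\<And>\<zeta>. \<zeta> < length B \<Longrightarrow> v ! \<zeta> \<le> v' ! \<zeta>"
    and x: "\<And>i. i \<in> xpoints B \<Longrightarrow>
              v' ! seg_before B i - v ! seg_before B i = v' ! seg_after B i - v ! seg_after B i"
  shows "moment_fiber B v' (\<lambda>\<sigma>. 0) \<noteq> {}"
proof -
  from fib obtain m where m: "m \<in> Mtilde B v"
    and mm: "\<And>\<zeta>. \<zeta> < length B \<Longrightarrow>
      contrib_after (m \<zeta>) + contrib_before (m (next_elt B \<zeta>)) = param B v (\<lambda>\<sigma>. 0) \<zeta>"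
    unfolding ex_in_conv[symmetric] moment_fiber_iff by auto
  define k where "k \<zeta> = v' ! \<zeta> - v ! \<zeta>" for \<zeta>
  have v': "v' ! \<zeta> = v ! \<zeta> + k \<zeta>" if "\<zeta> < length B" for \<zeta> using le[OF that] unfolding k_def by simp
  have uminus0: "- 0\<^sub>m j j = (0\<^sub>m j j :: complex mat)" for j by (rule eq_matI) auto
  have param0: "param B w (\<lambda>\<sigma>. 0) \<zeta> = 0\<^sub>m (w ! \<zeta>) (w ! \<zeta>)" if "\<zeta> < length B" for w \<zeta>
    unfolding param_def using that by (auto intro!: eq_matI)
  define pad where "pad i =
    (case m i of
       Arrow_data C D \<Rightarrow> Arrow_data (mat_direct_sum C (0\<^sub>m (k i) (k (seg_before B i))))
                                   (mat_direct_sum D (0\<^sub>m (k (seg_before B i)) (k i)))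
     | XPoint_data A Bm Bp a b \<Rightarrow> XPoint_data (mat_direct_sum A (1\<^sub>m (k i)))
         (mat_direct_sum Bm (0\<^sub>m (k i) (k i))) (mat_direct_sum Bp (0\<^sub>m (k i) (k i)))
         (a @\<^sub>r 0\<^sub>m (k i) 1) (append_cols b (0\<^sub>m 1 (k i))))" for i
  have pad: "pad i \<in> elt_space B v' i \<and>
      contrib_after (pad i) = mat_direct_sum (contrib_after (m i)) (0\<^sub>m (k i) (k i)) \<and>
      contrib_before (pad i) =
        mat_direct_sum (contrib_before (m i)) (0\<^sub>m (k (seg_before B i)) (k (seg_before B i))) \<and>
      contrib_after (m i) \<in> carrier_mat (v ! i) (v ! i) \<and>
      contrib_before (m i) \<in> carrier_mat (v ! seg_before B i) (v ! seg_before B i)"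
    if i: "i < length B" for i
  proof -
    have mi: "m i \<in> elt_space B v i" using m i unfolding Mtilde_def by auto
    have s: "seg_before B i < length B" using seg_before_less[OF ne] .
    show ?thesis
    proof (cases "B ! i")
      case Arrow
      with mi obtain C D where CD: "m i = Arrow_data C D"
        and C: "C \<in> carrier_mat (v ! i) (v ! seg_before B i)"
        and D: "D \<in> carrier_mat (v ! seg_before B i) (v ! i)"
        unfolding elt_space_def arrow_space_def seg_after_def by auto
      let ?C = "0\<^sub>m (k i) (k (seg_before B i)) :: complex mat"
      let ?D = "0\<^sub>m (k (seg_before B i)) (k i) :: complex mat"
      have "mat_direct_sum C ?C * mat_direct_sum D ?D = mat_direct_sum (C * D) (?C * ?D)"
        using C D by (intro mat_direct_sum_mult) auto
      moreover have "mat_direct_sum D ?D * mat_direct_sum C ?C = mat_direct_sum (D * C) (?D * ?C)"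
        using C D by (intro mat_direct_sum_mult) auto
      ultimately show ?thesis
        using Arrow CD C D i s
        by (auto simp: pad_def elt_space_def arrow_space_def seg_after_def v' mat_direct_sum_uminus uminus0)
    next
      case XPoint
      with i have "i \<in> xpoints B" unfolding xpoints_def by auto
      from x[OF this] have kk: "k (seg_before B i) = k i" unfolding k_def seg_after_def by simp
      from XPoint mi obtain A Bm Bp a b where X: "m i = XPoint_data A Bm Bp a b"
        and Xm: "XPoint_data A Bm Bp a b \<in> xpoint_space (v ! seg_before B i) (v ! i)"
        unfolding elt_space_def xpoint_space_def seg_after_def by auto
      have "pad i \<in> elt_space B v' i"
        using xpoint_pad[OF Xm, of "k i"] XPoint i s
        by (simp add: pad_def X elt_space_def seg_after_def v' kk)
      moreover have "Bm \<in> carrier_mat (v ! seg_before B i) (v ! seg_before B i)"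
        "Bp \<in> carrier_mat (v ! i) (v ! i)"
        using Xm unfolding xpoint_space_iff by auto
      ultimately show ?thesis by (auto simp: pad_def X kk mat_direct_sum_uminus uminus0)
    qed
  qed
  have "restrict pad {..<length B} \<in> moment_fiber B v' (\<lambda>\<sigma>. 0)"
    unfolding moment_fiber_iff
  proof (intro conjI allI impI)
    show "restrict pad {..<length B} \<in> Mtilde B v'" unfolding Mtilde_def using pad by auto
  next
    fix \<zeta> assume z: "\<zeta> < length B"
    let ?n = "next_elt B \<zeta>"
    have n: "?n < length B" using next_elt_less[OF ne] .
    have sn: "seg_before B ?n = \<zeta>" using seg_before_next_elt[OF z] .
    have "contrib_after (pad \<zeta>) + contrib_before (pad ?n) =
        mat_direct_sum (contrib_after (m \<zeta>) + contrib_before (m ?n)) (0\<^sub>m (k \<zeta>) (k \<zeta>))"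
      using pad[OF z] pad[OF n] unfolding sn
      by (auto simp: mat_direct_sum_add[of _ "v ! \<zeta>" "v ! \<zeta>" _ "k \<zeta>" "k \<zeta>"])
    also have "\<dots> = mat_direct_sum (0\<^sub>m (v ! \<zeta>) (v ! \<zeta>)) (0\<^sub>m (k \<zeta>) (k \<zeta>))"
      unfolding mm[OF z] param0[OF z] ..
    also have "\<dots> = param B v' (\<lambda>\<sigma>. 0) \<zeta>"
      using v'[OF z] by (simp add: param0[OF z])
    finally show "contrib_after (restrict pad {..<length B} \<zeta>) +
        contrib_before (restrict pad {..<length B} ?n) = param B v' (\<lambda>\<sigma>. 0) \<zeta>"
      using z n by simp
  qed
  then show ?thesis by auto
qed

text \<open>
  The two ends of the segment receive the blocks \<open>r\<close> and \<open>r + c\<close>, where \<open>c\<close> is the value of the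
  parameter there. It is \<open>0\<close> unless the diagram has no arrows and the segment is the designated first
  one. The resolvents exist for all but finitely many \<open>r\<close>, and no other component of the moment map
  changes.
\<close>

lemma moment_fiber_extend_segment:
  assumes fib: "moment_fiber B v lam \<noteq> {}" and len: "length v = length B"
    and x1: "x1 \<in> xpoints B" and x2: "x2 \<in> xpoints B" and neq: "x1 \<noteq> x2"
    and cons: "seg_before B x2 = x1"
  shows "moment_fiber B (v[x1 := v ! x1 + 1]) lam \<noteq> {}"
proof -
  from fib obtain m where m: "m \<in> Mtilde B v"
    and mm: "\<And>\<zeta>. \<zeta> < length B \<Longrightarrow>
      contrib_after (m \<zeta>) + contrib_before (m (next_elt B \<zeta>)) = param B v lam \<zeta>"
    unfolding ex_in_conv[symmetric] moment_fiber_iff by auto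
  from x1 x2 have i1: "x1 < length B" "B ! x1 = XPoint" and i2: "x2 < length B" "B ! x2 = XPoint"
    unfolding xpoints_def by auto
  then have ne: "B \<noteq> []" by auto
  have next1: "next_elt B x1 = x2" using next_elt_seg_before[OF i2(1)] cons by simp
  have before_x1: "seg_before B i = x1 \<longleftrightarrow> i = x2" if "i < length B" for i
    using next_elt_seg_before[OF that] next1 cons by auto
  have mi: "m i \<in> elt_space B v i" if "i < length B" for i using m that unfolding Mtilde_def by auto
  from mi[OF i1(1)] i1(2) obtain A1 Bm1 Bp1 a1 b1 where X1: "m x1 = XPoint_data A1 Bm1 Bp1 a1 b1"
    and X1m: "XPoint_data A1 Bm1 Bp1 a1 b1 \<in> xpoint_space (v ! seg_before B x1) (v ! x1)"
    unfolding elt_space_def xpoint_space_def seg_after_def by auto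
  from mi[OF i2(1)] i2(2) obtain A2 Bm2 Bp2 a2 b2 where X2: "m x2 = XPoint_data A2 Bm2 Bp2 a2 b2"
    and X2m: "XPoint_data A2 Bm2 Bp2 a2 b2 \<in> xpoint_space (v ! x1) (v ! x2)"
    unfolding elt_space_def xpoint_space_def seg_after_def using cons by auto
  from X1m have B1: "Bm1 \<in> carrier_mat (v ! seg_before B x1) (v ! seg_before B x1)"
    "Bp1 \<in> carrier_mat (v ! x1) (v ! x1)" unfolding xpoint_space_iff by auto
  from X2m have B2: "Bm2 \<in> carrier_mat (v ! x1) (v ! x1)"
    "Bp2 \<in> carrier_mat (v ! x2) (v ! x2)" unfolding xpoint_space_iff by auto
  define c where "c = (if x1 \<in> wavy_lines B then lam x1 else 0)"
  have param_x1: "param B w lam x1 = c \<cdot>\<^sub>m 1\<^sub>m (w ! x1)" for w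
    unfolding param_def c_def using i1 by (auto intro!: eq_matI)
  \<comment> \<open>The finitely many \<open>r\<close> for which \<open>r\<close> or \<open>r + c\<close> is an eigenvalue of one of the old blocks.\<close>
  define bad where "bad = spectrum Bm1 \<union> spectrum Bp1 \<union> (\<lambda>z. z - c) ` (spectrum Bm2 \<union> spectrum Bp2)"
  have "finite bad" unfolding bad_def using B1 B2 by (auto simp: card_finite_spectrum)
  then obtain r where "r \<notin> bad" using ex_new_if_finite[OF infinite_UNIV_char_0] by blast
  then have "(r + c) - c \<notin> (\<lambda>z. z - c) ` (spectrum Bm2 \<union> spectrum Bp2)"
    unfolding bad_def by simp
  then have shifted: "r + c \<notin> spectrum Bm2 \<union> spectrum Bp2"
    by (rule contrapos_nn) (rule imageI)
  from \<open>r \<notin> bad\<close> have r: "\<not> eigenvalue Bm1 r" "\<not> eigenvalue Bp1 r"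
    "\<not> eigenvalue Bm2 (r + c)" "\<not> eigenvalue Bp2 (r + c)"
    using shifted unfolding bad_def spectrum_def by auto
  obtain A1' a1' where X1': "XPoint_data A1' Bm1 (mat_direct_sum Bp1 (r \<cdot>\<^sub>m 1\<^sub>m 1)) a1' b1
      \<in> xpoint_space (v ! seg_before B x1) (v ! x1 + 1)"
    using xpoint_extend_after[OF X1m r(1,2)] by blast
  obtain A2' b2' where X2': "XPoint_data A2' (mat_direct_sum Bm2 ((r + c) \<cdot>\<^sub>m 1\<^sub>m 1)) Bp2 a2 b2'
      \<in> xpoint_space (v ! x1 + 1) (v ! x2)"
    using xpoint_extend_before[OF X2m r(3,4)] by blast
  define v' where "v' = v[x1 := v ! x1 + 1]"
  have v'_x1: "v' ! x1 = v ! x1 + 1" and v'_other: "\<And>\<zeta>. \<zeta> \<noteq> x1 \<Longrightarrow> v' ! \<zeta> = v ! \<zeta>"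
    unfolding v'_def using i1 len by auto
  define m' where "m' = m(x1 := XPoint_data A1' Bm1 (mat_direct_sum Bp1 (r \<cdot>\<^sub>m 1\<^sub>m 1)) a1' b1,
      x2 := XPoint_data A2' (mat_direct_sum Bm2 ((r + c) \<cdot>\<^sub>m 1\<^sub>m 1)) Bp2 a2 b2')"
  have "m' \<in> moment_fiber B v' lam"
    unfolding moment_fiber_iff
  proof (intro conjI allI impI)
    have "m' i \<in> elt_space B v' i" if i: "i < length B" for i
    proof -
      consider "i = x1" | "i = x2" | "i \<noteq> x1" "i \<noteq> x2" by blast
      then show ?thesis
      proof cases
        case 1
        have "seg_before B x1 \<noteq> x1" using before_x1[OF i1(1)] neq by simp
        then show ?thesis
          using 1 X1' i1 neq by (simp add: m'_def elt_space_def seg_after_def v'_x1 v'_other)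
      next
        case 2
        then show ?thesis
          using X2' i2 neq by (simp add: m'_def elt_space_def seg_after_def cons v'_x1 v'_other)
      next
        case 3
        then have "seg_before B i \<noteq> x1" using before_x1[OF i] by simp
        then have "elt_space B v' i = elt_space B v i"
          using 3 by (simp add: elt_space_def seg_after_def v'_other cong: bow_elt.case_cong)
        then show ?thesis using 3 mi[OF i] by (simp add: m'_def)
      qed
    qed
    moreover have "m' i = undefined" if "i \<notin> {..<length B}" for i
      using m that i1 i2 unfolding Mtilde_def m'_def by auto
    ultimately show "m' \<in> Mtilde B v'" unfolding Mtilde_def by auto
  next
    fix \<zeta> assume z: "\<zeta> < length B"
    show "contrib_after (m' \<zeta>) + contrib_before (m' (next_elt B \<zeta>)) = param B v' lam \<zeta>"
    proof (cases "\<zeta> = x1")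
      case True
      have "contrib_after (m' \<zeta>) + contrib_before (m' (next_elt B \<zeta>)) =
          mat_direct_sum (- Bp1) (- (r \<cdot>\<^sub>m 1\<^sub>m 1)) + mat_direct_sum Bm2 ((r + c) \<cdot>\<^sub>m 1\<^sub>m 1)"
        using True next1 neq by (simp add: m'_def mat_direct_sum_uminus)
      also have "\<dots> = mat_direct_sum (- Bp1 + Bm2) (- (r \<cdot>\<^sub>m 1\<^sub>m 1) + (r + c) \<cdot>\<^sub>m 1\<^sub>m 1)"
        using B1 B2 by (intro mat_direct_sum_add[of _ "v ! x1" "v ! x1" _ 1 1]) auto
      also have "- Bp1 + Bm2 = c \<cdot>\<^sub>m 1\<^sub>m (v ! x1)"
        using mm[OF i1(1)] by (simp add: next1 X1 X2 param_x1)
      also have "- (r \<cdot>\<^sub>m 1\<^sub>m 1) + (r + c) \<cdot>\<^sub>m 1\<^sub>m 1 = c \<cdot>\<^sub>m 1\<^sub>m 1"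
        by (rule eq_matI) auto
      also have "mat_direct_sum (c \<cdot>\<^sub>m 1\<^sub>m (v ! x1)) (c \<cdot>\<^sub>m 1\<^sub>m 1) = param B v' lam \<zeta>"
        unfolding mat_direct_sum_smult_one using True by (simp add: param_x1 v'_x1)
      finally show ?thesis .
    next
      case False
      have "next_elt B \<zeta> \<noteq> x2" using False seg_before_next_elt[OF z] cons by auto
      then have "contrib_after (m' \<zeta>) + contrib_before (m' (next_elt B \<zeta>)) =
          contrib_after (m \<zeta>) + contrib_before (m (next_elt B \<zeta>))"
        using False by (auto simp: m'_def X1 X2)
      also have "\<dots> = param B v' lam \<zeta>"
        unfolding mm[OF z] using z False by (simp add: param_def v'_other)
      finally show ?thesis .
    qed
  qed
  then show ?thesis unfolding v'_def by auto
qed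

lemma moment_fiber_enlarge_segment:
  assumes fib: "moment_fiber B v lam \<noteq> {}" and len: "length v = length B"
    and x1: "x1 \<in> xpoints B" and x2: "x2 \<in> xpoints B" and neq: "x1 \<noteq> x2"
    and cons: "seg_before B x2 = x1"
  shows "moment_fiber B (v[x1 := v ! x1 + k]) lam \<noteq> {}"
proof (induction k)
  case 0
  then show ?case using fib by simp
next
  case (Suc k)
  have "x1 < length v" using x1 len unfolding xpoints_def by simp
  with moment_fiber_extend_segment[OF Suc _ x1 x2 neq cons] len show ?case by simp
qed

section \<open>Increments of dimension vectors\<close>

text \<open>
  An x-point is never one of the two cutting arrows, so both adjacent segments lie in the same arc.
\<close>

lemma susy_increment_step_xpoint:
  assumes st: "susy_increment_step B v v'" and i: "i \<in> xpoints B"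
  shows "v' ! seg_before B i - v ! seg_before B i = v' ! i - v ! i"
proof -
  from st obtain e e' where e: "e \<in> arrows B" "e' \<in> arrows B"
    and S: "\<forall>S \<in> {circle_arc B e e', circle_arc B e' e}. \<forall>\<zeta> \<in> S. \<forall>\<zeta>' \<in> S.
           v' ! \<zeta> - v ! \<zeta> = v' ! \<zeta>' - v ! \<zeta>'"
    unfolding susy_increment_step_def by (elim conjE bexE)
  from e i have len: "e < length B" "e' < length B" "i < length B" and ne: "i \<noteq> e" "i \<noteq> e'"
    unfolding arrows_def xpoints_def by auto
  have sb: "seg_before B i = (if i = 0 then length B - 1 else i - 1)"
    using len seg_before_Suc[of "i - 1" B] seg_before_0[of B] by auto
  have "\<exists>S \<in> {circle_arc B e e', circle_arc B e' e}. seg_before B i \<in> S \<and> i \<in> S"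
    using len ne unfolding sb circle_arc_def by auto
  then obtain T where T: "T \<in> {circle_arc B e e', circle_arc B e' e}" "seg_before B i \<in> T" "i \<in> T"
    by (elim bexE conjE)
  show ?thesis using S[rule_format, OF T] .
qed

lemma susy_increment_xpoint:
  assumes "susy_increment B v v'"
  shows "length v' = length B \<and> (\<forall>\<zeta> < length B. v ! \<zeta> \<le> v' ! \<zeta>) \<and>
    (\<forall>i \<in> xpoints B. v' ! seg_before B i - v ! seg_before B i = v' ! i - v ! i)"
  using assms unfolding susy_increment_def
proof (induction rule: tranclp_induct)
  case (base v')
  then show ?case using susy_increment_step_xpoint[OF base] unfolding susy_increment_step_def by auto
next
  case (step v' v'')
  have "length v'' = length B" "\<forall>\<zeta> < length B. v' ! \<zeta> \<le> v'' ! \<zeta>"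
    using step.hyps(2) unfolding susy_increment_step_def by auto
  moreover have "v'' ! seg_before B i - v ! seg_before B i = v'' ! i - v ! i" if "i \<in> xpoints B" for i
  proof -
    have "v' ! seg_before B i - v ! seg_before B i = v' ! i - v ! i" using step.IH that by blast
    then show ?thesis using susy_increment_step_xpoint[OF step.hyps(2) that] by linarith
  qed
  ultimately show ?case using step.IH by fastforce
qed

theorem theorem5p16:
  fixes B :: bow and v :: "nat list" and lam :: "nat \<Rightarrow> complex"
  assumes "B \<noteq> []"
    and "length v = length B"
    and "moment_fiber B v lam \<noteq> {}"
  shows "((\<forall>\<sigma> \<in> wavy_lines B. lam \<sigma> = 0) \<longrightarrow>
           (\<forall>vnew :: nat list. susy_increment B (map int v) (map int vnew) \<longrightarrow>
              moment_fiber B vnew (\<lambda>\<sigma>. 0) \<noteq> {}))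
       \<and> (\<forall>x1 \<in> xpoints B. \<forall>x2 \<in> xpoints B. \<forall>\<zeta>. \<forall>vnew :: nat list.
            x1 \<noteq> x2 \<and> seg_after B x1 = \<zeta> \<and> seg_before B x2 = \<zeta> \<and>
            length vnew = length B \<and> v ! \<zeta> \<le> vnew ! \<zeta> \<and>
            (\<forall>\<zeta>' < length B. \<zeta>' \<noteq> \<zeta> \<longrightarrow> vnew ! \<zeta>' = v ! \<zeta>') \<longrightarrow>
            moment_fiber B vnew lam \<noteq> {})"
proof (intro conjI impI allI ballI)
  fix vnew :: "nat list"
  assume lam: "\<forall>\<sigma> \<in> wavy_lines B. lam \<sigma> = 0" and "susy_increment B (map int v) (map int vnew)"
  note inc = susy_increment_xpoint[OF this(2)]
  have len: "length vnew = length B" using inc by simp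
  have "param B v lam = param B v (\<lambda>\<sigma>. 0)" using lam by (auto simp: param_def fun_eq_iff)
  then have fib: "moment_fiber B v (\<lambda>\<sigma>. 0) \<noteq> {}" using assms(3) by (simp add: moment_fiber_def)
  show "moment_fiber B vnew (\<lambda>\<sigma>. 0) \<noteq> {}"
  proof (rule moment_fiber_pad[OF assms(1) fib assms(2) len])
    show "v ! \<zeta> \<le> vnew ! \<zeta>" if "\<zeta> < length B" for \<zeta>
      using inc that len assms(2) by (auto simp: nth_map)
    show "vnew ! seg_before B i - v ! seg_before B i = vnew ! seg_after B i - v ! seg_after B i"
      if i: "i \<in> xpoints B" for i
    proof -
      have l: "i < length B" "seg_before B i < length B"
        using i seg_before_less[OF assms(1)] unfolding xpoints_def by auto
      then have "int (vnew ! seg_before B i) - int (v ! seg_before B i) = int (vnew ! i) - int (v ! i)"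
        using inc i len assms(2) by (metis nth_map)
      then show ?thesis unfolding seg_after_def by linarith
    qed
  qed
next
  fix x1 x2 \<zeta> and vnew :: "nat list"
  assume x1: "x1 \<in> xpoints B" and x2: "x2 \<in> xpoints B"
    and A: "x1 \<noteq> x2 \<and> seg_after B x1 = \<zeta> \<and> seg_before B x2 = \<zeta> \<and>
            length vnew = length B \<and> v ! \<zeta> \<le> vnew ! \<zeta> \<and>
            (\<forall>\<zeta>' < length B. \<zeta>' \<noteq> \<zeta> \<longrightarrow> vnew ! \<zeta>' = v ! \<zeta>')"
  then have z: "\<zeta> = x1" and cons: "seg_before B x2 = x1" and neq: "x1 \<noteq> x2"
    unfolding seg_after_def by auto
  have "vnew = v[x1 := v ! x1 + (vnew ! x1 - v ! x1)]"
  proof (rule nth_equalityI)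
    show "length vnew = length (v[x1 := v ! x1 + (vnew ! x1 - v ! x1)])" using A assms(2) by simp
    show "vnew ! i = v[x1 := v ! x1 + (vnew ! x1 - v ! x1)] ! i" if "i < length vnew" for i
      using A assms(2) that unfolding z by (cases "i = x1") auto
  qed
  then show "moment_fiber B vnew lam \<noteq> {}"
    using moment_fiber_enlarge_segment[OF assms(3,2) x1 x2 neq cons] by metis
qed

end
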